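(* Let $G:\mathbb{H}\to\mathbb{R}$ be locally Lipschitz smooth and $\mu$-strongly convex (both with respect to the $\mathcal{L}$-norm). Let $x_0\in\mathbb{H}$, $\eta=\sqrt\mu$, $r>1$, let $$\mathfrak{B}=\{x\in\mathbb{H}:\|x-x^*\|_{\mathcal{L}}\le R\},\qquad R=\sqrt{\tfrac{2}{\mu}(G(x_0)-G^* )}+\tfrac1\eta\sqrt{2r(G(x_0)-G^* )},$$ and let $L_B>0$ be the Lipschitz smoothness constant of $G$ associated with $\mathfrak{B}$. Suppose PAGD is applied from $x_0$ with friction coefficient $\eta=\sqrt{\mu}$ and step size $$s\in\left(0,\ \min\left\{L_B^{-1},\ \left(\tfrac{r-1}{r+1}\right)^2\mu^{-1}\right\}\right],$$ and write $\theta=\eta\sqrt{s}$. Then, with $$E(X,V)=\frac{\eta}{2}\|V\|_{\mathcal{L}}^2+\frac1\eta\,(G(X)-G^* ),\qquad E_0=\frac1\eta(G(x_0)-G^* )+\frac\eta2\|x_0-x^*\|_{\mathcal{L}}^2,$$ one has, for all $k\ge0$, $$E(x_{k+1},v_{k+1}-x^* )\le(1-\theta)\,E(x_k,v_k-x^* ),\qquad E(x_k,v_k-x^* )\le(1-\theta)^k E_0.$$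
   Context: $\mathbb{H}$ is a real separable Hilbert space with norm $\|\cdot\|_{\mathbb{H}}$, $\mathbb{H}'$ is its dual, and $\langle f,v\rangle=f(v)$ is the duality pairing. The preconditioner $\mathcal{L}:\mathbb{H}\to\mathbb{H}'$ is a linear operator such that, with $(x,y)_{\mathcal{L}}:=\langle\mathcal{L}x,y\rangle$, there are $C_1,C_2>0$ with $(x,y)_{\mathcal{L}}=(y,x)_{\mathcal{L}}$, $(x,y)_{\mathcal{L}}\le C_2\|x\|_{\mathbb{H}}\|y\|_{\mathbb{H}}$, and $C_1\|x\|_{\mathbb{H}}^2\le (x,x)_{\mathcal{L}}$ for all $x,y\in\mathbb{H}$. Then $\|x\|_{\mathcal{L}}:=\sqrt{(x,x)_{\mathcal{L}}}$ is a norm equivalent to $\|\cdot\|_{\mathbb{H}}$ and $\mathcal{L}$ is invertible. $G:\mathbb{H}\to\mathbb{R}$ is Fréchet differentiable at every point, with derivative $G'(x)\in\mathbb{H}'$. $G$ is $\mu$-strongly convex if $\mu>0$ and $\langle G'(x)-G'(y),x-y\rangle\ge\mu\|x-y\|_{\mathcal{L}}^2$ for all $x,y\in\mathbb{H}$. $G$ is locally Lipschitz smooth if for every bounded convex set $B\subset\mathbb{H}$ there is $L_B>0$ such that $\langle G'(x)-G'(y),x-y\rangle\le L_B\|x-y\|_{\mathcal{L}}^2$ for all $x,y\in B$; such an $L_B$ is called a (local) Lipschitz smoothness constant associated with $B$. $x^*$ denotes the unique minimizer of $G$ over $\mathbb{H}$ and $G^*=G(x^* )$. PAGD (preconditioned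 accelerated gradient descent) with friction coefficient $\eta>0$, step size $s>0$ and initial guess $x_0\in\mathbb{H}$: set $\theta=\eta\sqrt{s}$, $\lambda=\frac{1-\theta}{1+\theta}$, $x_{-1}=v_0=x_0$, and for $k\ge0$ $$y_k=x_k+\lambda(x_k-x_{k-1}),\qquad x_{k+1}=y_k-s\,\mathcal{L}^{-1}G'(y_k),\qquad v_{k+1}=x_k+\tfrac1\theta(x_{k+1}-x_k).$$ *)

theory Defs
  imports "HOL-Analysis.Analysis"
begin

definition L_inner ::
  "('h::real_normed_vector \<Rightarrow> 'h \<Rightarrow>\<^sub>L real) \<Rightarrow> 'h \<Rightarrow> 'h \<Rightarrow> real" where
  "L_inner \<L> x y = blinfun_apply (\<L> x) y"

definition L_norm ::
  "('h::real_normed_vector \<Rightarrow> 'h \<Rightarrow>\<^sub>L real) \<Rightarrow> 'h \<Rightarrow> real" where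
  "L_norm \<L> x = sqrt (L_inner \<L> x x)"

definition preconditioner ::
  "('h::real_normed_vector \<Rightarrow> 'h \<Rightarrow>\<^sub>L real) \<Rightarrow> bool" where
  "preconditioner \<L> \<longleftrightarrow>
     linear \<L> \<and>
     (\<exists>C\<^sub>1>0. \<exists>C\<^sub>2>0. \<forall>x y.
        L_inner \<L> x y = L_inner \<L> y x \<and>
        L_inner \<L> x y \<le> C\<^sub>2 * norm x * norm y \<and>
        C\<^sub>1 * (norm x)\<^sup>2 \<le> L_inner \<L> x x)"

text \<open>In the following notions \<open>G'\<close> is the Frechet derivative of the objective, regarded as
  a map into the dual space.\<close>

definition strongly_convex ::
  "('h::real_normed_vector \<Rightarrow> 'h \<Rightarrow>\<^sub>L real) \<Rightarrow> ('h \<Rightarrow> 'h \<Rightarrow>\<^sub>L real) \<Rightarrow> real \<Rightarrow> bool" where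
  "strongly_convex \<L> G' \<mu> \<longleftrightarrow>
     \<mu> > 0 \<and>
     (\<forall>x y. blinfun_apply (G' x - G' y) (x - y) \<ge> \<mu> * (L_norm \<L> (x - y))\<^sup>2)"

definition smoothness_constant ::
  "('h::real_normed_vector \<Rightarrow> 'h \<Rightarrow>\<^sub>L real) \<Rightarrow> ('h \<Rightarrow> 'h \<Rightarrow>\<^sub>L real) \<Rightarrow> 'h set \<Rightarrow> real \<Rightarrow> bool" where
  "smoothness_constant \<L> G' B L \<longleftrightarrow>
     L > 0 \<and>
     (\<forall>x\<in>B. \<forall>y\<in>B. blinfun_apply (G' x - G' y) (x - y) \<le> L * (L_norm \<L> (x - y))\<^sup>2)"

definition locally_lipschitz_smooth ::
  "('h::real_normed_vector \<Rightarrow> 'h \<Rightarrow>\<^sub>L real) \<Rightarrow> ('h \<Rightarrow> 'h \<Rightarrow>\<^sub>L real) \<Rightarrow> bool" where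
  "locally_lipschitz_smooth \<L> G' \<longleftrightarrow>
     (\<forall>B. bounded B \<and> convex B \<longrightarrow> (\<exists>L. smoothness_constant \<L> G' B L))"

definition minimizer :: "('h \<Rightarrow> real) \<Rightarrow> 'h" where
  "minimizer G = (THE x. \<forall>y. G x \<le> G y)"

text \<open>The state after \<open>k\<close> steps is the pair \<open>(x\<^sub>k\<^sub>-\<^sub>1, x\<^sub>k)\<close>, which
  accommodates the initialisation \<open>x\<^sub>-\<^sub>1 = x\<^sub>0\<close>.\<close>

definition pagd_extrapolate :: "real \<Rightarrow> real \<Rightarrow> 'h::real_vector \<times> 'h \<Rightarrow> 'h" where
  "pagd_extrapolate \<eta> s p =
     (let \<theta> = \<eta> * sqrt s; lam = (1 - \<theta>) / (1 + \<theta>)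
      in snd p + lam *\<^sub>R (snd p - fst p))"

primrec pagd_state ::
  "('h::real_normed_vector \<Rightarrow> 'h \<Rightarrow>\<^sub>L real) \<Rightarrow> ('h \<Rightarrow> 'h \<Rightarrow>\<^sub>L real) \<Rightarrow> real \<Rightarrow> real \<Rightarrow> 'h \<Rightarrow> nat \<Rightarrow> 'h \<times> 'h"
where
  "pagd_state \<L> G' \<eta> s x\<^sub>0 0 = (x\<^sub>0, x\<^sub>0)"
| "pagd_state \<L> G' \<eta> s x\<^sub>0 (Suc k) =
     (let p = pagd_state \<L> G' \<eta> s x\<^sub>0 k; y = pagd_extrapolate \<eta> s p
      in (snd p, y - s *\<^sub>R inv \<L> (G' y)))"

definition pagd_x ::
  "('h::real_normed_vector \<Rightarrow> 'h \<Rightarrow>\<^sub>L real) \<Rightarrow> ('h \<Rightarrow> 'h \<Rightarrow>\<^sub>L real) \<Rightarrow> real \<Rightarrow> real \<Rightarrow> 'h \<Rightarrow> nat \<Rightarrow> 'h"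
where
  "pagd_x \<L> G' \<eta> s x\<^sub>0 k = snd (pagd_state \<L> G' \<eta> s x\<^sub>0 k)"

primrec pagd_v ::
  "('h::real_normed_vector \<Rightarrow> 'h \<Rightarrow>\<^sub>L real) \<Rightarrow> ('h \<Rightarrow> 'h \<Rightarrow>\<^sub>L real) \<Rightarrow> real \<Rightarrow> real \<Rightarrow> 'h \<Rightarrow> nat \<Rightarrow> 'h"
where
  "pagd_v \<L> G' \<eta> s x\<^sub>0 0 = x\<^sub>0"
| "pagd_v \<L> G' \<eta> s x\<^sub>0 (Suc k) =
     pagd_x \<L> G' \<eta> s x\<^sub>0 k +
     (1 / (\<eta> * sqrt s)) *\<^sub>R (pagd_x \<L> G' \<eta> s x\<^sub>0 (Suc k) - pagd_x \<L> G' \<eta> s x\<^sub>0 k)"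

definition energy ::
  "('h::real_normed_vector \<Rightarrow> 'h \<Rightarrow>\<^sub>L real) \<Rightarrow> ('h \<Rightarrow> real) \<Rightarrow> real \<Rightarrow> 'h \<Rightarrow> 'h \<Rightarrow> real" where
  "energy \<L> G \<eta> X V = \<eta> / 2 * (L_norm \<L> V)\<^sup>2 + 1 / \<eta> * (G X - G (minimizer G))"

end

theory Submission
  imports Defs
begin

text \<open>Write \<open>g\<close> for the \<open>\<L>\<close>-gradient \<open>\<L>\<^sup>-\<^sup>1 (G' y)\<close> at the extrapolated point \<open>y\<close>, let all
  norms be \<open>\<L>\<close>-norms, and multiply the energy by \<open>\<eta>\<close> to obtain
  \<open>\<Phi>\<^sub>k = \<mu>/2 \<parallel>v\<^sub>k - x\<^sup>*\<parallel>\<^sup>2 + G x\<^sub>k - G x\<^sup>*\<close>. The recursion says that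
  \<open>(1 + \<theta>) y\<^sub>k = x\<^sub>k + \<theta> v\<^sub>k\<close> (lemma \<open>extrapolate_convex_combination\<close>), so that
  \<open>v\<^sub>k\<^sub>+\<^sub>1 - x\<^sup>* = (1 - \<theta>)(v\<^sub>k - x\<^sup>*) + \<theta> (y\<^sub>k - x\<^sup>*) - (s/\<theta>) g\<close>. Expanding the square, using
  \<open>\<theta>\<^sup>2 = \<mu> s\<close>, and adding the strong convexity inequalities from \<open>y\<^sub>k\<close> to \<open>x\<^sub>k\<close> and from \<open>y\<^sub>k\<close>
  to \<open>x\<^sup>*\<close> with weights \<open>1 - \<theta>\<close> and \<open>\<theta>\<close>, one gets \<open>\<Phi>\<^sub>k\<^sub>+\<^sub>1 \<le> (1 - \<theta>) \<Phi>\<^sub>k\<close> as soon as the step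
  satisfies the descent estimate \<open>G x\<^sub>k\<^sub>+\<^sub>1 \<le> G y\<^sub>k - s/2 \<parallel>g\<parallel>\<^sup>2\<close> (lemma \<open>lyapunov_step\<close>).

  Smoothness is only local, so the descent estimate needs both \<open>y\<^sub>k\<close> and \<open>x\<^sub>k\<^sub>+\<^sub>1\<close> in the ball of
  radius \<open>R\<close> around \<open>x\<^sup>*\<close>. Put \<open>D = G x\<^sub>0 - G x\<^sup>*\<close>. As long as the energy has not increased,
  \<open>\<Phi>\<^sub>k \<le> \<Phi>\<^sub>0 \<le> 2 D\<close>, and quadratic growth of \<open>G\<close> gives
  \<open>\<parallel>x\<^sub>k - x\<^sup>*\<parallel>\<^sup>2, \<parallel>v\<^sub>k - x\<^sup>*\<parallel>\<^sup>2 \<le> 4 D/\<mu>\<close>, hence the same for the convex combination \<open>y\<^sub>k\<close>.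
  Since \<open>R\<^sup>2 \<ge> 8 D/\<mu>\<close>, the point \<open>y\<^sub>k\<close> lies strictly inside the ball unless \<open>D = 0\<close> and
  \<open>y\<^sub>k = x\<^sup>*\<close>, and a continuity argument shows that the gradient step cannot leave the ball (lemma
  \<open>gradient_step_descent\<close>).

  Existence of the minimizer and invertibility of \<open>\<L>\<close> both follow from the fact that a strongly
  convex function on a complete space attains its infimum (lemma
  \<open>uniformly_convex_attains_inf\<close>).\<close>

section \<open>First-order bounds from monotonicity of the derivative\<close>

text \<open>The constant \<open>c\<close> plays the role of a modulus of monotonicity times the squared length of \<open>d\<close>,
  for whichever norm the modulus refers to.\<close>

lemma first_order_lower_bound:
  fixes G :: "'a::real_normed_vector \<Rightarrow> real" and G' :: "'a \<Rightarrow> 'a \<Rightarrow>\<^sub>L real"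
  assumes deriv: "\<And>x. (G has_derivative blinfun_apply (G' x)) (at x)"
    and mono: "\<And>t. 0 < t \<Longrightarrow> t \<le> 1 \<Longrightarrow> blinfun_apply (G' (x + t *\<^sub>R d) - G' x) (t *\<^sub>R d) \<ge> c * t\<^sup>2"
  shows "G (x + d) \<ge> G x + blinfun_apply (G' x) d + c / 2"
proof -
  define \<phi> where "\<phi> t = G (x + t *\<^sub>R d) - t * blinfun_apply (G' x) d - c * t\<^sup>2 / 2" for t :: real
  have d: "(\<phi> has_real_derivative (blinfun_apply (G' (x + t *\<^sub>R d)) d - blinfun_apply (G' x) d - c * t)) (at t)" for t
  proof -
    have "((\<lambda>t. G (x + t *\<^sub>R d)) has_derivative (\<lambda>h. blinfun_apply (G' (x + t *\<^sub>R d)) (h *\<^sub>R d))) (at t)"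
      by (rule has_derivative_compose[OF _ deriv]) (auto intro!: derivative_eq_intros)
    hence "((\<lambda>t. G (x + t *\<^sub>R d)) has_real_derivative (blinfun_apply (G' (x + t *\<^sub>R d)) d)) (at t)"
      unfolding has_field_derivative_def
      by (rule has_derivative_eq_rhs) (auto simp: blinfun.scaleR_right fun_eq_iff)
    thus ?thesis unfolding \<phi>_def by (auto intro!: derivative_eq_intros)
  qed
  have "\<phi> 0 \<le> \<phi> 1"
  proof (rule DERIV_nonneg_imp_nondecreasing[where f = \<phi>])
    fix t :: real assume t: "0 \<le> t" "t \<le> 1"
    have "blinfun_apply (G' (x + t *\<^sub>R d)) d - blinfun_apply (G' x) d - c * t \<ge> 0"
    proof (cases "t = 0")
      case False
      with t mono[of t] have "t * (blinfun_apply (G' (x + t *\<^sub>R d)) d - blinfun_apply (G' x) d - c * t) \<ge> 0"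
        by (simp add: blinfun.diff_left blinfun.scaleR_right algebra_simps power2_eq_square)
      with t False show ?thesis by (simp add: zero_le_mult_iff)
    qed simp
    with d[of t] show "\<exists>y. (\<phi> has_real_derivative y) (at t) \<and> 0 \<le> y" by blast
  qed simp
  thus ?thesis by (simp add: \<phi>_def)
qed

lemma first_order_upper_bound:
  fixes G :: "'a::real_normed_vector \<Rightarrow> real" and G' :: "'a \<Rightarrow> 'a \<Rightarrow>\<^sub>L real"
  assumes deriv: "\<And>x. (G has_derivative blinfun_apply (G' x)) (at x)"
    and mono: "\<And>t. 0 < t \<Longrightarrow> t \<le> 1 \<Longrightarrow> blinfun_apply (G' (x + t *\<^sub>R d) - G' x) (t *\<^sub>R d) \<le> c * t\<^sup>2"
  shows "G (x + d) \<le> G x + blinfun_apply (G' x) d + c / 2"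
proof -
  have "- G (x + d) \<ge> - G x + blinfun_apply (- G' x) d + (- c) / 2"
  proof (rule first_order_lower_bound[where G = "\<lambda>x. - G x" and G' = "\<lambda>x. - G' x"])
    show "((\<lambda>x. - G x) has_derivative blinfun_apply (- G' x)) (at x)" for x
      by (rule has_derivative_eq_rhs[OF has_derivative_minus[OF deriv]])
        (simp add: fun_eq_iff blinfun.minus_left)
    show "blinfun_apply (- G' (x + t *\<^sub>R d) - - G' x) (t *\<^sub>R d) \<ge> - c * t\<^sup>2" if "0 < t" "t \<le> 1" for t
      using mono[OF that] by (simp add: blinfun.diff_left blinfun.minus_left)
  qed
  thus ?thesis by (simp add: blinfun.minus_left)
qed

section \<open>Minimizers of strongly convex functions\<close>

text \<open>A minimizing sequence is Cauchy, by the strong convexity inequality at midpoints; no weak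
  compactness is needed. The map \<open>G'\<close> need not be the derivative of
  \<open>G\<close>: any selection satisfying the quadratically strengthened subgradient inequality will do.\<close>

lemma uniformly_convex_attains_inf:
  fixes G :: "'a::{real_normed_vector, complete_space} \<Rightarrow> real" and G' :: "'a \<Rightarrow> 'a \<Rightarrow>\<^sub>L real"
  assumes cont: "continuous_on UNIV G" and c: "c > 0"
    and lower: "\<And>x y. G y \<ge> G x + blinfun_apply (G' x) (y - x) + c * (norm (y - x))\<^sup>2"
  shows "\<exists>x. \<forall>y. G x \<le> G y"
proof -
  have bdd: "bdd_below (range G)"
  proof (rule bdd_belowI2)
    fix y :: 'a
    \<comment> \<open>The quadratic term absorbs the linear one: complete the square in \<open>norm y\<close>.\<close>
    have "\<bar>blinfun_apply (G' 0) y\<bar> \<le> norm (G' 0) * norm y" using norm_blinfun[of "G' 0" y] by simp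
    moreover have "0 \<le> c * (norm y - norm (G' 0) / (2 * c))\<^sup>2" using c by simp
    moreover have "c * (norm y - norm (G' 0) / (2 * c))\<^sup>2
        = c * (norm y)\<^sup>2 - norm (G' 0) * norm y + (norm (G' 0))\<^sup>2 / (4 * c)"
      using c by (simp add: power2_eq_square field_simps)
    ultimately show "G 0 - (norm (G' 0))\<^sup>2 / (4 * c) \<le> G y"
      using lower[of 0 y] by simp
  qed
  define m where "m = Inf (range G)"
  have m: "m \<le> G x" for x unfolding m_def by (rule cInf_lower[OF _ bdd]) simp
  have gap: "2 * c * (norm (x - y))\<^sup>2 \<le> 4 * (G x + G y - 2 * m)" for x y
  proof -
    let ?z = "(1 / 2) *\<^sub>R (x + y)" and ?h = "(1 / 2) *\<^sub>R (x - y)"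
    have e: "x - ?z = ?h" "y - ?z = - ?h" by (simp_all add: algebra_simps flip: scaleR_2 scaleR_add_left)
    have n: "(norm ?h)\<^sup>2 = (norm (x - y))\<^sup>2 / 4" by (simp add: power2_eq_square)
    have "G x \<ge> G ?z + blinfun_apply (G' ?z) ?h + c * ((norm (x - y))\<^sup>2 / 4)"
      using lower[of ?z x] unfolding e n .
    moreover have "G y \<ge> G ?z - blinfun_apply (G' ?z) ?h + c * ((norm (x - y))\<^sup>2 / 4)"
      using lower[of ?z y] unfolding e norm_minus_cancel n by (simp add: blinfun.minus_right)
    ultimately show ?thesis using m[of ?z] by simp
  qed
  have "\<exists>x. G x < m + inverse (real (Suc n))" for n
    using cInf_lessD[of "range G" "m + inverse (real (Suc n))"] by (auto simp: m_def)
  then obtain X where X: "\<And>n. G (X n) < m + inverse (real (Suc n))" by metis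
  have "Cauchy X"
  proof (rule metric_CauchyI)
    fix e :: real assume e: "e > 0"
    have "c * e\<^sup>2 / 4 > 0" using c e by simp
    then obtain N where N: "inverse (real (Suc N)) < c * e\<^sup>2 / 4" using reals_Archimedean by blast
    have close: "G (X n) < m + c * e\<^sup>2 / 4" if "n \<ge> N" for n
    proof -
      have "inverse (real (Suc n)) \<le> inverse (real (Suc N))" using that by (intro le_imp_inverse_le) auto
      thus ?thesis using X[of n] N by linarith
    qed
    have "dist (X i) (X j) < e" if "i \<ge> N" "j \<ge> N" for i j
    proof -
      have "2 * c * (norm (X i - X j))\<^sup>2 < 2 * c * e\<^sup>2"
        using gap[of "X i" "X j"] close[OF that(1)] close[OF that(2)] by simp
      hence "(norm (X i - X j))\<^sup>2 < e\<^sup>2" using c by simp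
      thus ?thesis using e by (simp add: dist_norm power_less_imp_less_base)
    qed
    thus "\<exists>M. \<forall>i\<ge>M. \<forall>j\<ge>M. dist (X i) (X j) < e" by blast
  qed
  then obtain x where x: "X \<longlonglongrightarrow> x" using Cauchy_convergent convergent_def by blast
  have "(\<lambda>n. G (X n)) \<longlonglongrightarrow> G x"
    using continuous_on_tendsto_compose[OF cont x] by simp
  moreover have "(\<lambda>n. m + inverse (real (Suc n))) \<longlonglongrightarrow> m + 0"
    by (intro tendsto_intros LIMSEQ_inverse_real_of_nat)
  ultimately have "G x \<le> m + 0"
    by (rule LIMSEQ_le) (use X in \<open>auto intro: less_imp_le\<close>)
  thus ?thesis using m by (metis add_0_right order_trans)
qed

section \<open>The bilinear form of a preconditioner\<close>

text \<open>A preconditioner on a complete normed space. Coercivity and boundedness make the norm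
  equivalent to the one induced by the form, so an ambient inner product need not be assumed.\<close>

locale preconditioned =
  fixes \<L> :: "'h::{real_normed_vector, complete_space} \<Rightarrow> 'h \<Rightarrow>\<^sub>L real"
  assumes precond: "preconditioner \<L>"
begin

text \<open>The inner product \<open>(x, y)\<^sub>\<L>\<close> and the square of the \<open>\<L>\<close>-norm.\<close>

abbreviation ip :: "'h \<Rightarrow> 'h \<Rightarrow> real" where "ip \<equiv> L_inner \<L>"
abbreviation sq :: "'h \<Rightarrow> real" where "sq z \<equiv> ip z z"

lemma linear_precond: "linear \<L>"
  using precond by (simp add: preconditioner_def)

lemma ip_commute: "ip a b = ip b a"
  using precond unfolding preconditioner_def by blast

lemma ip_simps:
  "ip (a + b) z = ip a z + ip b z" "ip z (a + b) = ip z a + ip z b"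
  "ip (a - b) z = ip a z - ip b z" "ip z (a - b) = ip z a - ip z b"
  "ip (- a) z = - ip a z" "ip z (- a) = - ip z a"
  "ip (t *\<^sub>R a) z = t * ip a z" "ip z (t *\<^sub>R a) = t * ip z a"
  "ip 0 z = 0" "ip z 0 = 0"
  using linear_precond
  by (simp_all add: L_inner_def blinfun.add_left blinfun.add_right blinfun.diff_left
      blinfun.diff_right blinfun.minus_left blinfun.minus_right blinfun.scaleR_left
      blinfun.scaleR_right blinfun.zero_left blinfun.zero_right
      linear_add linear_diff linear_neg linear_cmul linear_0)

lemma coercive: obtains C where "C > 0" "\<And>z. C * (norm z)\<^sup>2 \<le> sq z"
  using precond unfolding preconditioner_def by blast

lemma sq_nonneg: "0 \<le> sq z"
  by (rule coercive) (metis order_trans mult_nonneg_nonneg less_imp_le zero_le_power2)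

lemma sq_le_0_iff: "sq z \<le> 0 \<longleftrightarrow> z = 0"
proof
  assume z: "sq z \<le> 0"
  obtain C where "C > 0" "C * (norm z)\<^sup>2 \<le> sq z" using coercive by metis
  with z have "C * (norm z)\<^sup>2 \<le> 0" by linarith
  with \<open>C > 0\<close> show "z = 0" by (simp add: mult_le_0_iff)
qed (simp add: ip_simps)

lemma L_norm_squared: "(L_norm \<L> z)\<^sup>2 = sq z"
  by (simp add: L_norm_def sq_nonneg)

lemma sq_convex_combination:
  "sq ((1 - t) *\<^sub>R a + t *\<^sub>R b) = (1 - t) * sq a + t * sq b - t * (1 - t) * sq (a - b)"
  by (simp add: ip_simps ip_commute[of b a] algebra_simps)

lemma sq_convex:
  assumes "0 \<le> t" "t \<le> 1" "sq a \<le> K" "sq b \<le> K"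
  shows "sq ((1 - t) *\<^sub>R a + t *\<^sub>R b) \<le> K"
proof -
  have "(1 - t) * sq a + t * sq b \<le> K" using assms by (intro convex_bound_le) auto
  moreover have "0 \<le> t * (1 - t) * sq (a - b)" using assms sq_nonneg by simp
  ultimately show ?thesis by (simp add: sq_convex_combination)
qed

lemma bounded_bilinear_ip: "bounded_bilinear ip"
proof -
  obtain C where C: "C > 0" "\<And>x y. ip x y \<le> C * norm x * norm y"
    using precond unfolding preconditioner_def by blast
  have "\<bar>ip x y\<bar> \<le> norm x * norm y * C" for x y
    using C(2)[of x y] C(2)[of "- x" y] by (auto simp: abs_le_iff ip_simps mult_ac)
  thus ?thesis by unfold_locales (auto simp: ip_simps)
qed

text \<open>The Lax--Milgram (Riesz) representation of functionals: \<open>\<L> z = f\<close> is the stationarity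
  condition of the strongly convex quadratic \<open>(z, z)\<^sub>\<L> / 2 - f z\<close>.\<close>

lemma surj_precond: "surj \<L>"
proof -
  have "\<exists>z. \<L> z = f" for f
  proof -
    define F where "F z = sq z / 2 - blinfun_apply f z" for z
    obtain C where C: "C > 0" "\<And>z. C * (norm z)\<^sup>2 \<le> sq z" using coercive by metis
    have dF: "(F has_derivative blinfun_apply (\<L> z - f)) (at z)" for z
    proof -
      have "((\<lambda>z. ip z z) has_derivative (\<lambda>h. ip z h + ip h z)) (at z)"
        by (rule bounded_bilinear.FDERIV[OF bounded_bilinear_ip]) (rule has_derivative_ident)+
      moreover have "(\<lambda>h. ip z h + ip h z) = (\<lambda>h. 2 * ip z h)"
      proof
        show "ip z h + ip h z = 2 * ip z h" for h using ip_commute[of h z] by simp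
      qed
      ultimately have "(sq has_derivative (\<lambda>h. 2 * ip z h)) (at z)" by simp
      hence "(F has_derivative (\<lambda>h. 2 * ip z h / 2 - blinfun_apply f h)) (at z)"
        unfolding F_def
        by (intro has_derivative_diff bounded_linear.has_derivative[OF bounded_linear_divide]
            bounded_linear_imp_has_derivative blinfun.bounded_linear_right)
      thus ?thesis
        by (rule has_derivative_eq_rhs) (simp add: fun_eq_iff blinfun.diff_left L_inner_def)
    qed
    have "\<exists>z. \<forall>y. F z \<le> F y"
    proof (rule uniformly_convex_attains_inf[where G' = "\<lambda>z. \<L> z - f" and c = "C / 2"])
      show "continuous_on UNIV F"
        using dF has_derivative_continuous continuous_at_imp_continuous_on by blast
      show "C / 2 > 0" using C by simp
      fix a b :: 'h
      have "F b = F a + blinfun_apply (\<L> a - f) (b - a) + sq (b - a) / 2"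
        by (simp add: F_def blinfun.diff_left blinfun.diff_right ip_simps ip_commute[of b a]
            L_inner_def[symmetric] field_simps)
      thus "F b \<ge> F a + blinfun_apply (\<L> a - f) (b - a) + C / 2 * (norm (b - a))\<^sup>2"
        using C(2)[of "b - a"] by simp
    qed
    then obtain z where z: "\<And>y. F z \<le> F y" by blast
    have "blinfun_apply (\<L> z - f) = (\<lambda>v. 0)"
      using differential_zero_maxmin[OF _ open_UNIV dF[of z]] z by auto
    hence "\<L> z = f" by (intro blinfun_eqI) (simp add: fun_eq_iff blinfun.diff_left)
    thus ?thesis ..
  qed
  thus ?thesis unfolding surj_def by metis
qed

lemma precond_inv: "\<L> (inv \<L> f) = f"
  by (rule surj_f_inv_f[OF surj_precond])

end

section \<open>Strongly convex objectives\<close>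

text \<open>An everywhere Frechet differentiable objective \<open>G\<close> with derivative \<open>G'\<close>, strongly convex with
  modulus \<open>\<mu>\<close> in the \<open>\<L>\<close>-norm.\<close>

locale preconditioned_problem = preconditioned \<L>
  for \<L> :: "'h::{real_normed_vector, complete_space} \<Rightarrow> 'h \<Rightarrow>\<^sub>L real" +
  fixes G :: "'h \<Rightarrow> real" and G' :: "'h \<Rightarrow> 'h \<Rightarrow>\<^sub>L real" and \<mu> :: real
  assumes deriv: "\<And>x. (G has_derivative blinfun_apply (G' x)) (at x)"
    and convex: "strongly_convex \<L> G' \<mu>"
begin

lemma mu_pos: "\<mu> > 0"
  using convex by (simp add: strongly_convex_def)

lemma strong_convexity:
  "G y \<ge> G x + blinfun_apply (G' x) (y - x) + \<mu> / 2 * sq (y - x)"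
proof -
  have "G (x + (y - x)) \<ge> G x + blinfun_apply (G' x) (y - x) + (\<mu> * sq (y - x)) / 2"
  proof (rule first_order_lower_bound[OF deriv])
    fix t :: real
    have "\<mu> * (L_norm \<L> (x + t *\<^sub>R (y - x) - x))\<^sup>2
        \<le> blinfun_apply (G' (x + t *\<^sub>R (y - x)) - G' x) (x + t *\<^sub>R (y - x) - x)"
      using convex unfolding strongly_convex_def by blast
    thus "\<mu> * sq (y - x) * t\<^sup>2 \<le> blinfun_apply (G' (x + t *\<^sub>R (y - x)) - G' x) (t *\<^sub>R (y - x))"
      by (simp add: L_norm_squared ip_simps(7,8) power2_eq_square[of t] mult_ac)
  qed
  thus ?thesis by simp
qed

lemma minimizer_exists: "\<exists>x. \<forall>y. G x \<le> G y"
proof -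
  obtain C where C: "C > 0" "\<And>z. C * (norm z)\<^sup>2 \<le> sq z" using coercive by metis
  show ?thesis
  proof (rule uniformly_convex_attains_inf[where G' = G' and c = "\<mu> / 2 * C"])
    show "continuous_on UNIV G"
      using deriv has_derivative_continuous continuous_at_imp_continuous_on by blast
    show "\<mu> / 2 * C > 0" using C mu_pos by simp
    show "G x + blinfun_apply (G' x) (y - x) + \<mu> / 2 * C * (norm (y - x))\<^sup>2 \<le> G y" for x y
    proof -
      have "\<mu> / 2 * (C * (norm (y - x))\<^sup>2) \<le> \<mu> / 2 * sq (y - x)"
        using C(2) mu_pos by (intro mult_left_mono) auto
      thus ?thesis using strong_convexity[of x y] by (simp add: mult.assoc)
    qed
  qed
qed

lemma stationary_of_minimal:
  assumes "\<And>y. G x \<le> G y" shows "G' x = 0"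
proof -
  have "blinfun_apply (G' x) = (\<lambda>v. 0)"
    using differential_zero_maxmin[OF _ open_UNIV deriv[of x]] assms by auto
  thus ?thesis by (intro blinfun_eqI) (simp add: blinfun.zero_left)
qed

lemma quadratic_growth:
  assumes "\<And>y. G x \<le> G y" shows "G y \<ge> G x + \<mu> / 2 * sq (y - x)"
  using strong_convexity[of x y] by (simp add: stationary_of_minimal[OF assms] blinfun.zero_left)

lemma minimizer_least: "G (minimizer G) \<le> G y"
proof -
  obtain a where a: "\<And>y. G a \<le> G y" using minimizer_exists by blast
  have "minimizer G = a"
    unfolding minimizer_def
  proof (rule the_equality)
    fix b assume b: "\<forall>y. G b \<le> G y"
    hence "\<mu> / 2 * sq (b - a) \<le> 0"
      using quadratic_growth[OF a, of b] b[rule_format, of a] by linarith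
    hence "sq (b - a) \<le> 0" using mu_pos by (simp add: mult_le_0_iff)
    thus "b = a" using sq_le_0_iff by fastforce
  qed (use a in blast)
  thus ?thesis using a by simp
qed

section \<open>A gradient step inside a ball of smoothness\<close>

lemma descent_on_ball:
  assumes smooth: "smoothness_constant \<L> G' {z. sq (z - c) \<le> K} M"
    and x: "sq (x - c) \<le> K" and y: "sq (y - c) \<le> K"
  shows "G y \<le> G x + blinfun_apply (G' x) (y - x) + M / 2 * sq (y - x)"
proof -
  have "G (x + (y - x)) \<le> G x + blinfun_apply (G' x) (y - x) + (M * sq (y - x)) / 2"
  proof (rule first_order_upper_bound[OF deriv])
    fix t :: real assume t: "0 < t" "t \<le> 1"
    have "x + t *\<^sub>R (y - x) - c = (1 - t) *\<^sub>R (x - c) + t *\<^sub>R (y - c)"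
      by (simp add: algebra_simps)
    hence "sq (x + t *\<^sub>R (y - x) - c) \<le> K"
      using sq_convex[of t "x - c" K "y - c"] t x y by simp
    hence "blinfun_apply (G' (x + t *\<^sub>R (y - x)) - G' x) (x + t *\<^sub>R (y - x) - x)
        \<le> M * (L_norm \<L> (x + t *\<^sub>R (y - x) - x))\<^sup>2"
      using smooth x unfolding smoothness_constant_def by blast
    thus "blinfun_apply (G' (x + t *\<^sub>R (y - x)) - G' x) (t *\<^sub>R (y - x)) \<le> M * sq (y - x) * t\<^sup>2"
      by (simp add: L_norm_squared ip_simps(7,8) power2_eq_square[of t] mult_ac)
  qed
  thus ?thesis by simp
qed

text \<open>The ball is centred at the minimizer \<open>c\<close>. As long as the segment from \<open>y\<close> in the direction
  \<open>- g\<close> of the negative gradient stays in the ball, the decrease of \<open>G\<close> forces the distance to the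
  minimizer not to grow. Hence a segment of length parameter \<open>s \<le> 1/M\<close> starting in the interior of
  the ball cannot reach its boundary, and the smoothness constant of the ball controls the whole
  step although only \<open>y\<close> is assumed to lie in the ball.\<close>

lemma gradient_step_descent:
  assumes smooth: "smoothness_constant \<L> G' {z. sq (z - c) \<le> K} M"
    and min: "\<And>y. G c \<le> G y"
    and y: "y = c \<or> sq (y - c) < K"
    and s: "0 \<le> s" "s * M \<le> 1"
    and g: "\<L> g = G' y"
  shows "G (y - s *\<^sub>R g) \<le> G y - s / 2 * sq g"
proof (cases "y = c")
  case True
  hence "\<L> g = 0" using stationary_of_minimal[OF min] g by simp
  hence "sq g \<le> 0" by (simp add: L_inner_def blinfun.zero_left)
  hence "g = 0" by (simp only: sq_le_0_iff)
  thus ?thesis by (simp add: ip_simps)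
next
  case False
  with y have yK: "sq (y - c) < K" by simp
  have M: "M > 0" using smooth by (simp add: smoothness_constant_def)
  have G'y: "blinfun_apply (G' y) w = ip g w" for w by (simp add: L_inner_def g)
  have decrease: "G (y - t *\<^sub>R g) \<le> G y - t / 2 * sq g"
    if t: "0 \<le> t" "t \<le> s" and in_ball: "sq (y - t *\<^sub>R g - c) \<le> K" for t
  proof -
    have "t * M \<le> 1" using s t M by (meson mult_right_mono less_imp_le order_trans)
    hence "t * M * (t * sq g) \<le> 1 * (t * sq g)"
      using t sq_nonneg by (intro mult_right_mono) auto
    moreover have "G (y - t *\<^sub>R g) \<le> G y - t * sq g + M / 2 * (t * (t * sq g))"
      using descent_on_ball[OF smooth less_imp_le[OF yK] in_ball] by (simp add: G'y ip_simps)
    ultimately show ?thesis by (simp add: algebra_simps)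
  qed
  have closer: "sq (y - t *\<^sub>R g - c) \<le> sq (y - c)"
    if t: "0 \<le> t" "t \<le> s" and in_ball: "sq (y - t *\<^sub>R g - c) \<le> K" for t
  proof -
    \<comment> \<open>Convexity bounds \<open>(g, y - c)\<^sub>\<L>\<close> below by \<open>G y - G c\<close>, which is at least the decrease
      achieved along the segment.\<close>
    have "0 \<le> \<mu> / 2 * sq (c - y)" using mu_pos sq_nonneg by simp
    hence "G c \<ge> G y + ip g (c - y)"
      using strong_convexity[of y c] by (simp add: G'y)
    moreover have "G c \<le> G y - t / 2 * sq g" using decrease[OF that] min order_trans by blast
    ultimately have "t * sq g \<le> 2 * ip g (y - c)" by (simp add: ip_simps)
    hence "t * (t * sq g) \<le> t * (2 * ip g (y - c))" using t by (intro mult_left_mono)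
    moreover have "y - t *\<^sub>R g - c = (y - c) - t *\<^sub>R g" by simp
    hence "sq (y - t *\<^sub>R g - c) = sq (y - c) - t * (2 * ip g (y - c)) + t * (t * sq g)"
      by (simp only: ip_simps(3,4,7,8) ip_commute[of c g] ip_commute[of y g]) (simp add: algebra_simps)
    ultimately show ?thesis by linarith
  qed
  have "sq (y - s *\<^sub>R g - c) \<le> K"
  proof (rule ccontr)
    assume out: "\<not> ?thesis"
    have "continuous_on {0..s} (\<lambda>t. sq (y - t *\<^sub>R g - c))"
      by (intro bounded_bilinear.continuous_on[OF bounded_bilinear_ip] continuous_intros)
    then obtain t where "0 \<le> t" "t \<le> s" "sq (y - t *\<^sub>R g - c) = K"
      using IVT'[of "\<lambda>t. sq (y - t *\<^sub>R g - c)" 0 K s] yK out s by auto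
    with closer[of t] yK show False by simp
  qed
  thus ?thesis using decrease[of s] s by simp
qed

section \<open>The discrete Lyapunov inequality\<close>

text \<open>One step of the iteration, with \<open>(x, v)\<close> the current and \<open>(x', v')\<close> the next pair of points.\<close>

lemma lyapunov_step:
  assumes min: "\<And>z. G c \<le> G z"
    and s: "s > 0" and th: "\<theta> > 0" "\<theta> \<le> 1" "\<theta>\<^sup>2 = \<mu> * s"
    and y: "(1 + \<theta>) *\<^sub>R y = x + \<theta> *\<^sub>R v"
    and g: "\<L> g = G' y"
    and x': "x' = y - s *\<^sub>R g" and v': "v' = x + (1 / \<theta>) *\<^sub>R (x' - x)"
    and descent: "G x' \<le> G y - s / 2 * sq g"
  shows "\<mu> / 2 * sq (v' - c) + (G x' - G c) \<le> (1 - \<theta>) * (\<mu> / 2 * sq (v - c) + (G x - G c))"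
proof -
  define a where "a = v - c"
  define b where "b = y - c"
  define w where "w = (1 - \<theta>) *\<^sub>R a + \<theta> *\<^sub>R b"
  have yx: "y - x = \<theta> *\<^sub>R (a - b)"
    using y by (simp add: a_def b_def algebra_simps)
  have "x' - x = \<theta> *\<^sub>R (a - b) - s *\<^sub>R g" by (simp add: x' yx[symmetric])
  hence "v' = x + ((a - b) - (s / \<theta>) *\<^sub>R g)"
    using th by (simp add: v' scaleR_right_diff_distrib)
  moreover have "x = y - \<theta> *\<^sub>R (a - b)" using yx by (simp add: algebra_simps)
  ultimately have v'w: "v' - c = w - (s / \<theta>) *\<^sub>R g"
    by (simp add: w_def b_def algebra_simps)
  have coef: "\<mu> * (s / \<theta>) = \<theta>" "\<mu> * (s / \<theta>) * (s / \<theta>) = s"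
    using th s mu_pos by (simp_all add: field_simps power2_eq_square)
  have "\<mu> / 2 * sq (v' - c) = \<mu> / 2 * sq w - \<mu> * (s / \<theta>) * ip g w + (\<mu> * (s / \<theta>) * (s / \<theta>)) / 2 * sq g"
    unfolding v'w by (simp only: ip_simps(3,4,7,8) ip_commute[of w g]) (simp add: algebra_simps)
  hence 1: "\<mu> / 2 * sq (v' - c) = \<mu> / 2 * sq w - \<theta> * ip g w + s / 2 * sq g"
    unfolding coef(2) unfolding coef(1) .
  have w: "sq w = (1 - \<theta>) * sq a + \<theta> * sq b - \<theta> * (1 - \<theta>) * sq (a - b)"
    unfolding w_def by (rule sq_convex_combination)
  have gw: "\<theta> * ip g w = (1 - \<theta>) * ip g (y - x) + \<theta> * ip g b"
    by (simp add: w_def yx ip_simps algebra_simps)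
  have G'y: "blinfun_apply (G' y) z = ip g z" for z by (simp add: L_inner_def g)
  have "0 \<le> \<mu> / 2 * sq (x - y)" using mu_pos sq_nonneg by simp
  hence cx: "G x \<ge> G y - ip g (y - x)"
    using strong_convexity[of y x] by (simp add: G'y ip_simps)
  have "c - y = - b" by (simp add: b_def)
  hence cc: "G c \<ge> G y - ip g b + \<mu> / 2 * sq b"
    using strong_convexity[of y c] by (simp add: G'y ip_simps(5,6))
  have "(1 - \<theta>) * (G x - (G y - ip g (y - x))) \<ge> 0" using th cx by simp
  moreover have "\<theta> * (G c - (G y - ip g b + \<mu> / 2 * sq b)) \<ge> 0" using th cc by simp
  moreover have "\<mu> / 2 * (\<theta> * (1 - \<theta>) * sq (a - b)) \<ge> 0" using mu_pos th sq_nonneg by simp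
  ultimately show ?thesis
    using descent unfolding 1 w gw a_def[symmetric]
    by (simp add: algebra_simps add_divide_distrib diff_divide_distrib)
qed

end

section \<open>Decay of the energy along the iteration\<close>

text \<open>At \<open>k = 0\<close> this holds because \<open>x\<^sub>-\<^sub>1 = v\<^sub>0 = x\<^sub>0\<close>; afterwards \<open>v\<^sub>k - x\<^sub>k\<close> is a multiple of the
  momentum \<open>x\<^sub>k - x\<^sub>k\<^sub>-\<^sub>1\<close>.\<close>

lemma extrapolate_convex_combination:
  assumes "\<theta> = \<eta> * sqrt s" "\<theta> > 0"
  shows "(1 + \<theta>) *\<^sub>R pagd_extrapolate \<eta> s (pagd_state \<L> G' \<eta> s x\<^sub>0 k)
    = pagd_x \<L> G' \<eta> s x\<^sub>0 k + \<theta> *\<^sub>R pagd_v \<L> G' \<eta> s x\<^sub>0 k"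
proof -
  define p where "p = pagd_state \<L> G' \<eta> s x\<^sub>0 k"
  have "\<theta> *\<^sub>R pagd_v \<L> G' \<eta> s x\<^sub>0 k = \<theta> *\<^sub>R fst p + (snd p - fst p)"
    using assms(2)
    by (cases k) (simp_all add: p_def pagd_x_def Let_def assms(1)[symmetric] scaleR_right_distrib)
  moreover have "(1 + \<theta>) *\<^sub>R pagd_extrapolate \<eta> s p
      = (1 + \<theta>) *\<^sub>R snd p + ((1 + \<theta>) * ((1 - \<theta>) / (1 + \<theta>))) *\<^sub>R (snd p - fst p)"
    by (simp add: pagd_extrapolate_def Let_def assms(1)[symmetric] scaleR_right_distrib del: times_divide_eq_right)
  moreover have "(1 + \<theta>) * ((1 - \<theta>) / (1 + \<theta>)) = 1 - \<theta>" using assms by simp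
  moreover have "(1 + \<theta>) *\<^sub>R snd p + (1 - \<theta>) *\<^sub>R (snd p - fst p)
      = snd p + (\<theta> *\<^sub>R fst p + (snd p - fst p))"
    by (simp add: algebra_simps)
  ultimately show ?thesis by (simp only: p_def[symmetric] pagd_x_def)
qed

theorem theorem5p8:
  fixes \<L> :: "'h::{real_inner, polish_space} \<Rightarrow> 'h \<Rightarrow>\<^sub>L real"
    and G :: "'h \<Rightarrow> real" and G' :: "'h \<Rightarrow> 'h \<Rightarrow>\<^sub>L real"
    and x\<^sub>0 xstar :: 'h and x v :: "nat \<Rightarrow> 'h" and B :: "'h set"
    and \<mu> \<eta> r R L\<^sub>B s \<theta> E\<^sub>0 :: real
  assumes precond: "preconditioner \<L>"
    and deriv: "\<And>x. (G has_derivative blinfun_apply (G' x)) (at x)"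
    and smooth: "locally_lipschitz_smooth \<L> G'"
    and convex: "strongly_convex \<L> G' \<mu>"
    and xstar: "xstar = minimizer G"
    and eta: "\<eta> = sqrt \<mu>"
    and r: "r > 1"
    and R: "R = sqrt (2 / \<mu> * (G x\<^sub>0 - G xstar)) + 1 / \<eta> * sqrt (2 * r * (G x\<^sub>0 - G xstar))"
    and B: "B = {x. L_norm \<L> (x - xstar) \<le> R}"
    and LB: "smoothness_constant \<L> G' B L\<^sub>B"
    and s_pos: "0 < s"
    and s_le: "s \<le> min (inverse L\<^sub>B) (((r - 1) / (r + 1))\<^sup>2 * inverse \<mu>)"
    and theta: "\<theta> = \<eta> * sqrt s"
    and x: "x = pagd_x \<L> G' \<eta> s x\<^sub>0"
    and v: "v = pagd_v \<L> G' \<eta> s x\<^sub>0"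
    and E0: "E\<^sub>0 = 1 / \<eta> * (G x\<^sub>0 - G xstar) + \<eta> / 2 * (L_norm \<L> (x\<^sub>0 - xstar))\<^sup>2"
  shows "\<forall>k. energy \<L> G \<eta> (x (Suc k)) (v (Suc k) - xstar)
                \<le> (1 - \<theta>) * energy \<L> G \<eta> (x k) (v k - xstar) \<and>
             energy \<L> G \<eta> (x k) (v k - xstar) \<le> (1 - \<theta>) ^ k * E\<^sub>0"
proof -
  interpret preconditioned_problem \<L> G G' \<mu>
    by unfold_locales (use precond deriv convex in auto)
  have min: "G xstar \<le> G z" for z using minimizer_least xstar by simp
  have eta_pos: "\<eta> > 0" and eta_sq: "\<eta>\<^sup>2 = \<mu>" using mu_pos eta by simp_all
  have th_pos: "\<theta> > 0" using eta_pos s_pos theta by simp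
  have th_sq: "\<theta>\<^sup>2 = \<mu> * s" using s_pos eta_sq by (simp add: theta power_mult_distrib)
  have th1: "\<theta> \<le> 1"
  proof -
    have "\<mu> * s \<le> \<mu> * (((r - 1) / (r + 1))\<^sup>2 * inverse \<mu>)"
      using s_le mu_pos by (intro mult_left_mono) auto
    also have "\<dots> = ((r - 1) / (r + 1))\<^sup>2" using mu_pos by simp
    also have "\<dots> \<le> 1" using r by (intro power_le_one) auto
    finally show ?thesis using th_sq th_pos by (intro power2_le_imp_le[of \<theta> 1]) auto
  qed
  have M: "L\<^sub>B > 0" using LB by (simp add: smoothness_constant_def)
  have sM: "s * L\<^sub>B \<le> 1" using s_le M by (simp add: field_simps)
  define D where "D = G x\<^sub>0 - G xstar"
  have D: "D \<ge> 0" using min by (simp add: D_def)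
  have R_eq: "R = sqrt (2 / \<mu> * D) * (1 + sqrt r)"
    using eta_pos by (simp add: R D_def[symmetric] eta real_sqrt_mult real_sqrt_divide field_simps)
  have R0: "R \<ge> 0" using r D mu_pos by (simp add: R_eq)
  have R_ge: "8 * D / \<mu> \<le> R\<^sup>2"
  proof -
    \<comment> \<open>The factor \<open>1 + sqrt r > 2\<close> gives the margin over the radius guaranteed by the energy.\<close>
    have "2\<^sup>2 \<le> (1 + sqrt r)\<^sup>2" using r by (intro power_mono) auto
    hence "2 / \<mu> * D * 4 \<le> 2 / \<mu> * D * (1 + sqrt r)\<^sup>2"
      using D mu_pos by (intro mult_left_mono) auto
    also have "\<dots> = R\<^sup>2" using D mu_pos by (simp add: R_eq power_mult_distrib)
    finally show ?thesis by simp
  qed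
  have ball: "B = {z. sq (z - xstar) \<le> R\<^sup>2}"
    unfolding B L_norm_def using R0 sq_nonneg by (auto simp: real_sqrt_le_iff' real_le_lsqrt sqrt_le_D)
  \<comment> \<open>The energy multiplied by \<open>\<eta>\<close>.\<close>
  define \<Phi> where "\<Phi> k = \<mu> / 2 * sq (v k - xstar) + (G (x k) - G xstar)" for k
  have energy_eq: "energy \<L> G \<eta> (x k) (v k - xstar) = \<Phi> k / \<eta>" for k
    using eta_pos
    by (simp add: energy_def \<Phi>_def L_norm_squared xstar[symmetric] eta_sq[symmetric]
        power2_eq_square[of \<eta>] field_simps)
  have E0_eq: "E\<^sub>0 = \<Phi> 0 / \<eta>"
    using eta_pos
    by (simp add: E0 \<Phi>_def x v pagd_x_def L_norm_squared eta_sq[symmetric]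
        power2_eq_square[of \<eta>] field_simps)
  have Phi0: "\<Phi> 0 \<le> 2 * D"
    using quadratic_growth[OF min, of x\<^sub>0] by (simp add: \<Phi>_def x v pagd_x_def D_def)
  have step: "\<Phi> (Suc k) \<le> (1 - \<theta>) * \<Phi> k" if Phi: "\<Phi> k \<le> 2 * D" for k
  proof -
    define y where "y = pagd_extrapolate \<eta> s (pagd_state \<L> G' \<eta> s x\<^sub>0 k)"
    define g where "g = inv \<L> (G' y)"
    have yc: "(1 + \<theta>) *\<^sub>R y = x k + \<theta> *\<^sub>R v k"
      unfolding y_def x v by (rule extrapolate_convex_combination[OF theta th_pos])
    have g: "\<L> g = G' y" by (simp add: g_def precond_inv)
    have x_Suc: "x (Suc k) = y - s *\<^sub>R g"
      by (simp add: x pagd_x_def y_def g_def Let_def)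
    have v_Suc: "v (Suc k) = x k + (1 / \<theta>) *\<^sub>R (x (Suc k) - x k)"
      by (simp add: v x theta)
    have "0 \<le> \<mu> / 2 * sq (v k - xstar)" using mu_pos sq_nonneg by simp
    hence "\<mu> / 2 * sq (x k - xstar) \<le> 2 * D"
      using quadratic_growth[OF min, of "x k"] Phi by (simp add: \<Phi>_def)
    hence xb: "sq (x k - xstar) \<le> 4 * D / \<mu>" using mu_pos by (simp add: field_simps)
    have "\<mu> / 2 * sq (v k - xstar) \<le> 2 * D" using min[of "x k"] Phi by (simp add: \<Phi>_def)
    hence vb: "sq (v k - xstar) \<le> 4 * D / \<mu>" using mu_pos by (simp add: field_simps)
    \<comment> \<open>The weight of \<open>v\<^sub>k\<close> in the convex combination \<open>y\<close>.\<close>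
    define t where "t = \<theta> / (1 + \<theta>)"
    have t: "0 \<le> t" "t \<le> 1" "(1 + \<theta>) * t = \<theta>" using th_pos by (simp_all add: t_def)
    have "(1 + \<theta>) *\<^sub>R (y - xstar) = (1 + \<theta>) *\<^sub>R ((1 - t) *\<^sub>R (x k - xstar) + t *\<^sub>R (v k - xstar))"
    proof -
      have "(1 + \<theta>) * (1 - t) = 1" using t(3) by (simp add: algebra_simps)
      hence "(1 + \<theta>) *\<^sub>R ((1 - t) *\<^sub>R (x k - xstar) + t *\<^sub>R (v k - xstar))
          = (x k - xstar) + \<theta> *\<^sub>R (v k - xstar)"
        by (simp only: scaleR_right_distrib scaleR_scaleR t(3)) simp
      also have "\<dots> = (1 + \<theta>) *\<^sub>R (y - xstar)"
        by (simp only: scaleR_right_diff_distrib yc) (simp add: algebra_simps)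
      finally show ?thesis by (rule sym)
    qed
    hence "y - xstar = (1 - t) *\<^sub>R (x k - xstar) + t *\<^sub>R (v k - xstar)"
      using th_pos unfolding scaleR_cancel_left by auto
    hence yb: "sq (y - xstar) \<le> 4 * D / \<mu>" using sq_convex[OF t(1,2) xb vb] by simp
    have "y = xstar \<or> sq (y - xstar) < R\<^sup>2"
    proof (cases "D = 0")
      \<comment> \<open>The ball degenerates to a point, and so does the iteration.\<close>
      case True
      with yb show ?thesis using sq_le_0_iff[of "y - xstar"] by simp
    next
      case False
      with D mu_pos have "4 * D / \<mu> < 8 * D / \<mu>" by (simp add: divide_strict_right_mono)
      with yb R_ge show ?thesis by linarith
    qed
    hence "G (x (Suc k)) \<le> G y - s / 2 * sq g"
      unfolding x_Suc
      by (intro gradient_step_descent[OF LB[unfolded ball] min _ less_imp_le[OF s_pos] sM g])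
    from lyapunov_step[OF min s_pos th_pos th1 th_sq yc g x_Suc v_Suc this]
    show ?thesis by (simp add: \<Phi>_def)
  qed
  have Phi_nonneg: "\<Phi> k \<ge> 0" for k
    using min[of "x k"] mu_pos sq_nonneg[of "v k - xstar"] by (simp add: \<Phi>_def)
  have bound: "\<Phi> k \<le> (1 - \<theta>) ^ k * \<Phi> 0 \<and> \<Phi> k \<le> 2 * D" for k
  proof (induction k)
    case 0
    show ?case using Phi0 by simp
  next
    case (Suc k)
    have "(1 - \<theta>) * \<Phi> k \<le> (1 - \<theta>) * ((1 - \<theta>) ^ k * \<Phi> 0)"
      using Suc th1 by (intro mult_left_mono) auto
    moreover have "(1 - \<theta>) * \<Phi> k \<le> 1 * \<Phi> k"
      using th_pos Phi_nonneg by (intro mult_right_mono) auto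
    ultimately show ?case using step[of k] Suc by (simp add: mult.assoc)
  qed
  show ?thesis
  proof (intro allI conjI)
    fix k
    have "\<Phi> (Suc k) / \<eta> \<le> ((1 - \<theta>) * \<Phi> k) / \<eta>"
      using step bound eta_pos by (intro divide_right_mono) auto
    thus "energy \<L> G \<eta> (x (Suc k)) (v (Suc k) - xstar)
        \<le> (1 - \<theta>) * energy \<L> G \<eta> (x k) (v k - xstar)"
      by (simp add: energy_eq)
    have "\<Phi> k / \<eta> \<le> ((1 - \<theta>) ^ k * \<Phi> 0) / \<eta>"
      using bound eta_pos by (intro divide_right_mono) auto
    thus "energy \<L> G \<eta> (x k) (v k - xstar) \<le> (1 - \<theta>) ^ k * E\<^sub>0"
      by (simp add: energy_eq E0_eq)
  qed
qed

end
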